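(* Let $N\ge 1$, $d:=2N$, and let $\Psi:M_d(\mathbb C)\to M_d(\mathbb C)$ be a completely positive trace-preserving complex-linear map. The following conditions are equivalent: (i) there are $\ell\in\mathbb N$ and matrices $L_1,\dots,L_\ell\in M_d(\mathbb C)$ forming a Kraus family for $\Psi$ (that is, $\Psi(X)=\sum_{s=1}^{\ell}L_sXL_s^\dagger$ for all $X\in M_d(\mathbb C)$) such that $L_s\Theta=\Theta L_s$ for every $s\in\{1,\dots,\ell\}$; (ii) the Choi matrix of $\Psi$ satisfies $\mathfrak C\, C_\Psi\,\mathfrak C^{-1}=C_\Psi$. When these conditions hold, a compatible Kraus family (as in (i)) can be chosen with every $L_s$ in the image of $\chi$, and $\Psi$ is the complex representation of a quaternionic channel, i.e. there are $A_1,\dots,A_\ell\in M_N(\mathbb H)$ with $\sum_{s}A_s^\dagger A_s=I_N$ and $\Psi(X)=\sum_{s}\chi(A_s)X\chi(A_s)^\dagger$ for all $X\in M_d(\mathbb C)$.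
   Context: $\mathbb H$ is the algebra of quaternions, with imaginary units $i,j,k=ij$, and $\mathbb C$ is identified with $\{a+bi:a,b\in\mathbb R\}\subset\mathbb H$. For $A\in M_N(\mathbb H)$, $A^\dagger$ is the quaternionic conjugate transpose. Every $A\in M_N(\mathbb H)$ is uniquely $A=B+Cj$ with $B,C\in M_N(\mathbb C)$, and $$\chi(A):=\begin{pmatrix}B&C\\-\overline C&\overline B\end{pmatrix}\in M_{2N}(\mathbb C).$$ For $s\in\mathbb N$, $\kappa_s:\mathbb C^s\to\mathbb C^s$ is entrywise complex conjugation in the standard basis. Put $J:=\begin{pmatrix}0&I_N\\-I_N&0\end{pmatrix}\in M_{2N}(\mathbb C)$ and $\Theta:=J\kappa_{2N}$, an antiunitary map of $\mathbb C^{2N}$ with $\Theta^2=-I_{2N}$. With $d=2N$ and $\mathbb C^d\otimes\mathbb C^d\cong\mathbb C^{d^2}$, put $\mathfrak C:=(J\otimes J)\kappa_{d^2}$, an antiunitary map with $\mathfrak C^2=I$. The Choi matrix of a complex-linear map $\Psi:M_d(\mathbb C)\to M_d(\mathbb C)$ is $$C_\Psi:=\sum_{\alpha,\beta=1}^d|\alpha\rangle\langle\beta|\otimes\Psi(|\alpha\rangle\langle\beta|)\in M_{d^2}(\mathbb C),$$ where $\{|\alpha\rangle\}$ is the standard basis of $\mathbb C^d$. A quaternionic channel is a map $\Phi:M_N(\mathbb H)\to M_N(\mathbb H)$ of the form $\Phi(\rho)=\sum_{r=1}^mA_r\rho A_r^\dagger$ with $A_r\in M_N(\mathbb H)$ and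 $\sum_rA_r^\dagger A_r=I_N$; its complex representation is the map $X\mapsto\sum_r\chi(A_r)X\chi(A_r)^\dagger$ on $M_{2N}(\mathbb C)$. *)

theory Defs
  imports "HOL-Analysis.Analysis"
begin

datatype quat = Quat (q_re: real) (q_i: real) (q_j: real) (q_k: real)

lemma quat_eq_iff:
  "p = q \<longleftrightarrow> q_re p = q_re q \<and> q_i p = q_i q \<and> q_j p = q_j q \<and> q_k p = q_k q"
  by (cases p; cases q) simp

instantiation quat :: ring_1
begin

definition "0 = Quat 0 0 0 0"

definition "1 = Quat 1 0 0 0"

definition "p + q = Quat (q_re p + q_re q) (q_i p + q_i q) (q_j p + q_j q) (q_k p + q_k q)"

definition "- p = Quat (- q_re p) (- q_i p) (- q_j p) (- q_k p)"

definition "p - q = Quat (q_re p - q_re q) (q_i p - q_i q) (q_j p - q_j q) (q_k p - q_k q)"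

definition "p * q = Quat
   (q_re p * q_re q - q_i p * q_i q - q_j p * q_j q - q_k p * q_k q)
   (q_re p * q_i q + q_i p * q_re q + q_j p * q_k q - q_k p * q_j q)
   (q_re p * q_j q - q_i p * q_k q + q_j p * q_re q + q_k p * q_i q)
   (q_re p * q_k q + q_i p * q_j q - q_j p * q_i q + q_k p * q_re q)"

instance
  by standard
    (simp_all add: quat_eq_iff zero_quat_def one_quat_def plus_quat_def uminus_quat_def
      minus_quat_def times_quat_def algebra_simps)

end

lemmas quat_defs = zero_quat_def one_quat_def plus_quat_def uminus_quat_def
  minus_quat_def times_quat_def

definition quat_cnj :: "quat \<Rightarrow> quat" where
  "quat_cnj q = Quat (q_re q) (- q_i q) (- q_j q) (- q_k q)"

lemma quat_units:
  "Quat 0 1 0 0 * Quat 0 1 0 0 = - 1"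
  "Quat 0 0 1 0 * Quat 0 0 1 0 = - 1"
  "Quat 0 1 0 0 * Quat 0 0 1 0 = Quat 0 0 0 1"
  "Quat 0 0 1 0 * Quat 0 1 0 0 = - Quat 0 0 0 1"
  by (simp_all add: quat_defs)

definition quat_of_complex :: "complex \<Rightarrow> quat" where
  "quat_of_complex z = Quat (Re z) (Im z) 0 0"

text \<open>
  The components \<open>b, c\<close> of the unique decomposition \<open>q = b + c j\<close> with \<open>b, c\<close> complex.
\<close>

definition quat_fst :: "quat \<Rightarrow> complex" where
  "quat_fst q = Complex (q_re q) (q_i q)"

definition quat_snd :: "quat \<Rightarrow> complex" where
  "quat_snd q = Complex (q_j q) (q_k q)"

lemma quat_decomposition:
  "q = quat_of_complex b + quat_of_complex c * Quat 0 0 1 0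
     \<longleftrightarrow> b = quat_fst q \<and> c = quat_snd q"
  by (auto simp: quat_eq_iff complex_eq_iff quat_of_complex_def quat_fst_def quat_snd_def quat_defs)

definition dagger :: "complex^'n^'m \<Rightarrow> complex^'m^'n" where
  "dagger A = transpose (map_matrix cnj A)"

definition quat_dagger :: "quat^'n^'m \<Rightarrow> quat^'m^'n" where
  "quat_dagger A = transpose (map_matrix quat_cnj A)"

definition block_matrix ::
  "complex^'n^'n \<Rightarrow> complex^'n^'n \<Rightarrow> complex^'n^'n \<Rightarrow> complex^'n^'n \<Rightarrow> complex^('n + 'n)^('n + 'n)"
where
  "block_matrix P Q R S = (\<chi> x y. case (x, y) of
       (Inl a, Inl b) \<Rightarrow> P $ a $ b
     | (Inl a, Inr b) \<Rightarrow> Q $ a $ b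
     | (Inr a, Inl b) \<Rightarrow> R $ a $ b
     | (Inr a, Inr b) \<Rightarrow> S $ a $ b)"

definition chi :: "quat^'n^'n \<Rightarrow> complex^('n + 'n)^('n + 'n)" where
  "chi A = (let B = map_matrix quat_fst A; C = map_matrix quat_snd A
     in block_matrix B C (- map_matrix cnj C) (map_matrix cnj B))"

text \<open>
  The space \<open>\<complex>\<^sup>m \<otimes> \<complex>\<^sup>n\<close> is \<open>complex^('m \<times> 'n)\<close>, with basis vector \<open>axis (i, j) 1\<close> for
  the tensor product of the basis vectors \<open>i\<close> and \<open>j\<close>.
\<close>

definition kron :: "complex^'b^'a \<Rightarrow> complex^'d^'c \<Rightarrow> complex^('b \<times> 'd)^('a \<times> 'c)" where
  "kron A B = (\<chi> x y. A $ fst x $ fst y * B $ snd x $ snd y)"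

definition kappa :: "complex^'s \<Rightarrow> complex^'s" where
  "kappa v = (\<chi> i. cnj (v $ i))"

definition matJ :: "complex^('n::finite + 'n)^('n + 'n)" where
  "matJ = block_matrix 0 (mat 1) (- mat 1) 0"

definition Theta :: "complex^('n::finite + 'n) \<Rightarrow> complex^('n + 'n)" where
  "Theta = (*v) matJ \<circ> kappa"

definition frakC ::
  "complex^(('n::finite + 'n) \<times> ('n + 'n)) \<Rightarrow> complex^(('n + 'n) \<times> ('n + 'n))"
where
  "frakC = (*v) (kron matJ matJ) \<circ> kappa"

lemma sum_sum_UNIV:
  fixes f :: "'a::finite + 'b::finite \<Rightarrow> 'c::comm_monoid_add"
  shows "(\<Sum>x\<in>UNIV. f x) = (\<Sum>a\<in>UNIV. f (Inl a)) + (\<Sum>b\<in>UNIV. f (Inr b))"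
  by (subst UNIV_Plus_UNIV[symmetric], subst sum.Plus) (auto)

lemma block_matrix_mult:
  "block_matrix P Q R S ** block_matrix P' Q' R' S' =
   block_matrix (P ** P' + Q ** R') (P ** Q' + Q ** S') (R ** P' + S ** R') (R ** Q' + S ** S')"
  by (simp add: block_matrix_def matrix_matrix_mult_def vec_eq_iff sum_sum_UNIV split: sum.split)

lemma block_matrix_uminus_mat: "block_matrix (-mat 1) 0 0 (-mat 1) = - mat 1"
  by (auto simp: block_matrix_def vec_eq_iff mat_def split: sum.split)

lemma matrix_mult_uminus: "A ** (- B) = - (A ** B)" "(-A) ** B = - (A ** B)" for A :: "complex^'n^'m" and B::"complex^'k^'n"
  by (simp_all add: matrix_matrix_mult_def vec_eq_iff sum_negf)

lemma matJ_mult_matJ: "matJ ** matJ = - mat 1"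
  by (simp add: matJ_def block_matrix_mult block_matrix_uminus_mat matrix_mult_uminus)

lemma kron_mult: "kron A B ** kron C D = kron (A ** C) (B ** D)"
  by (simp add: kron_def matrix_matrix_mult_def vec_eq_iff sum_product sum.cartesian_product mult_ac case_prod_beta)

lemma kappa_mult: "kappa (A *v v) = map_matrix cnj A *v kappa v"
  by (simp add: kappa_def matrix_vector_mult_def map_matrix_def vec_eq_iff)

lemma kappa_kappa: "kappa (kappa v) = v"
  by (simp add: kappa_def vec_eq_iff)

lemma cnj_matJ: "map_matrix cnj matJ = matJ"
  by (simp add: matJ_def block_matrix_def map_matrix_def mat_def vec_eq_iff split: sum.split)

lemma Theta_Theta: "Theta (Theta v) = - v"
  by (simp add: Theta_def kappa_mult kappa_kappa cnj_matJ matrix_vector_mul_assoc matJ_mult_matJ)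
    (metis matrix_vector_mul_lid matrix_vector_mult_diff_rdistrib diff_0 matrix_vector_mult_0)

lemma map_matrix_cnj_kron: "map_matrix cnj (kron A B) = kron (map_matrix cnj A) (map_matrix cnj B)"
  by (simp add: kron_def map_matrix_def vec_eq_iff)

lemma kron_uminus_mat: "kron (- mat 1) (- mat 1) = mat 1"
  by (auto simp: kron_def mat_def vec_eq_iff)

lemma frakC_frakC: "frakC (frakC v) = v"
  by (simp add: frakC_def kappa_mult kappa_kappa map_matrix_cnj_kron cnj_matJ
      matrix_vector_mul_assoc kron_mult matJ_mult_matJ kron_uminus_mat)

lemma inv_frakC: "inv frakC = frakC"
  by (rule inv_equality) (simp_all add: frakC_frakC)

definition mscale :: "complex \<Rightarrow> complex^'n^'m \<Rightarrow> complex^'n^'m" where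
  "mscale c = map_matrix ((*) c)"

lemma vector_space_mscale: "vector_space mscale"
  by unfold_locales (simp_all add: mscale_def map_matrix_def vec_eq_iff algebra_simps)

abbreviation complex_linear :: "(complex^'n^'n \<Rightarrow> complex^'n^'n) \<Rightarrow> bool" where
  "complex_linear \<equiv> Vector_Spaces.linear mscale mscale"

text \<open>
  An element of \<open>M\<^sub>k(\<complex>) \<otimes> M\<^sub>n(\<complex>)\<close> is given by its blocks \<open>F a b\<close> for \<open>a, b < k\<close>; for such an
  array, \<open>id \<otimes> \<Psi>\<close> acts blockwise. The sum below is the inner product \<open>\<langle>v, F v\<rangle>\<close>
  for the vector \<open>v\<close> with components \<open>v 0, \<dots>, v (k - 1)\<close>.
\<close>

definition block_psd :: "nat \<Rightarrow> (nat \<Rightarrow> nat \<Rightarrow> complex^'n^'n) \<Rightarrow> bool" where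
  "block_psd k F \<longleftrightarrow>
     (\<forall>v :: nat \<Rightarrow> complex^'n.
        (\<Sum>a<k. \<Sum>b<k. \<Sum>i\<in>UNIV. cnj (v a $ i) * (F a b *v v b) $ i) \<in> \<real>\<^sub>\<ge>\<^sub>0)"

definition completely_positive :: "(complex^'n^'n \<Rightarrow> complex^'n^'n) \<Rightarrow> bool" where
  "completely_positive \<Psi> \<longleftrightarrow>
     (\<forall>k F. block_psd k F \<longrightarrow> block_psd k (\<lambda>a b. \<Psi> (F a b)))"

definition trace_preserving :: "(complex^'n^'n \<Rightarrow> complex^'n^'n) \<Rightarrow> bool" where
  "trace_preserving \<Psi> \<longleftrightarrow> (\<forall>X. trace (\<Psi> X) = trace X)"

definition matrix_unit :: "'n \<Rightarrow> 'n \<Rightarrow> complex^'n^'n" where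
  "matrix_unit \<alpha> \<beta> = axis \<alpha> (axis \<beta> 1)"

definition choi :: "(complex^'n^'n \<Rightarrow> complex^'n^'n) \<Rightarrow> complex^('n \<times> 'n)^('n \<times> 'n)" where
  "choi \<Psi> = (\<Sum>\<alpha>\<in>UNIV. \<Sum>\<beta>\<in>UNIV. kron (matrix_unit \<alpha> \<beta>) (\<Psi> (matrix_unit \<alpha> \<beta>)))"

definition kraus_family ::
  "(complex^'n^'n \<Rightarrow> complex^'n^'n) \<Rightarrow> nat \<Rightarrow> (nat \<Rightarrow> complex^'n^'n) \<Rightarrow> bool"
where
  "kraus_family \<Psi> l L \<longleftrightarrow> (\<forall>X. \<Psi> X = (\<Sum>s=1..l. L s ** X ** dagger (L s)))"

definition quaternionic_channel_given_by ::
  "(quat^'n^'n \<Rightarrow> quat^'n^'n) \<Rightarrow> nat \<Rightarrow> (nat \<Rightarrow> quat^'n^'n) \<Rightarrow> bool"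
where
  "quaternionic_channel_given_by \<Phi> m A \<longleftrightarrow>
     (\<Sum>r=1..m. quat_dagger (A r) ** A r) = mat 1 \<and>
     (\<forall>\<rho>. \<Phi> \<rho> = (\<Sum>r=1..m. A r ** \<rho> ** quat_dagger (A r)))"

definition complex_representation ::
  "nat \<Rightarrow> (nat \<Rightarrow> quat^'n^'n) \<Rightarrow> complex^('n + 'n)^('n + 'n) \<Rightarrow> complex^('n + 'n)^('n + 'n)"
where
  "complex_representation m A X = (\<Sum>r=1..m. chi (A r) ** X ** dagger (chi (A r)))"

end

theory Submission
  imports Defs
begin

text \<open>
  Write \<open>\<sigma> A = \<Theta> A \<Theta>\<inverse>\<close>. This is a conjugate-linear, multiplicative and
  dagger-preserving involution of \<open>M\<^sub>d(\<complex>)\<close>, and both conditions of the theorem say that something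
  is fixed by it. A Kraus operator commutes with \<open>\<Theta>\<close> iff \<open>\<sigma> L = L\<close>. The Choi matrix commutes with
  the antiunitary \<open>(J \<otimes> J) \<kappa>\<close> iff \<open>\<sigma> \<circ> \<Psi> \<circ> \<sigma> = \<Psi>\<close>: conjugating \<open>\<Sum> E\<^sub>\<alpha>\<^sub>\<beta> \<otimes> \<Psi> E\<^sub>\<alpha>\<^sub>\<beta>\<close>
  applies \<open>\<sigma>\<close> to both tensor factors, and moving it from the first factor to the argument of
  \<open>\<Psi>\<close> gives the Choi matrix of \<open>\<sigma> \<circ> \<Psi> \<circ> \<sigma>\<close> (\<open>choi_Theta_conj\<close>).

  If \<open>(L\<^sub>s)\<close> is a Kraus family for \<open>\<Psi>\<close>, then \<open>(\<sigma> L\<^sub>s)\<close> is one for \<open>\<sigma> \<circ> \<Psi> \<circ> \<sigma>\<close>, so a family of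
  fixed operators makes \<open>\<Psi>\<close> invariant. Conversely let \<open>\<Psi>\<close> be invariant and take any Kraus family,
  which exists by Choi's theorem (\<open>kraus_family_exists\<close>). Then \<open>(L\<^sub>s)\<close> and \<open>(\<sigma> L\<^sub>s)\<close> both represent
  \<open>\<Psi>\<close>, hence so does their average. Splitting \<open>L = U + \<i> V\<close> into its parts with respect to the real
  structure \<open>\<sigma>\<close>, so that \<open>\<sigma> L = U - \<i> V\<close>, the parallelogram identity turns that average into the Kraus
  family of all \<open>U\<^sub>s\<close> and \<open>V\<^sub>s\<close>, which are fixed by \<open>\<sigma>\<close>
  (\<open>Theta_compatible_kraus_family_exists\<close>).

  The fixed points of \<open>\<sigma>\<close> are exactly the block matrices in the image of \<open>chi\<close>. Since \<open>chi\<close> is an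
  injective homomorphism compatible with the daggers, the normalisation \<open>\<Sum> L\<^sub>s\<^sup>\<dagger> L\<^sub>s = I\<close>, which
  follows from trace preservation, pulls back to the quaternionic matrices.
\<close>

section \<open>Conjugation by the antiunitary\<close>

text \<open>
  The conjugate \<open>\<Theta> A \<Theta>\<inverse>\<close>, written as a matrix; the sign comes from \<open>J\<inverse> = - J\<close>.
\<close>

definition Theta_conj ::
  "complex^('n::finite + 'n)^('n + 'n) \<Rightarrow> complex^('n + 'n)^('n + 'n)"
where
  "Theta_conj A = - (matJ ** map_matrix cnj A ** matJ)"

lemma map_matrix_cnj_mult:
  "map_matrix cnj (A ** B) = map_matrix cnj A ** map_matrix cnj B"
  by (simp add: matrix_matrix_mult_def vec_eq_iff)

lemma map_matrix_cnj_add: "map_matrix cnj (A + B) = map_matrix cnj A + map_matrix cnj B"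
  by (simp add: vec_eq_iff)

lemma matrix_mult_add_distrib:
  fixes A B :: "'a::semiring_1^'n^'m"
  shows "(A + B) ** C = A ** C + B ** C"
  by (simp add: matrix_matrix_mult_def vec_eq_iff distrib_right sum.distrib)

lemma map_matrix_cnj_uminus: "map_matrix cnj (- A) = - map_matrix cnj A"
  by (simp add: vec_eq_iff)

lemma map_matrix_cnj_cnj: "map_matrix cnj (map_matrix cnj A) = A"
  by (simp add: vec_eq_iff)

lemma dagger_mult: "dagger (A ** B) = dagger B ** dagger A"
  by (simp add: dagger_def map_matrix_cnj_mult matrix_transpose_mul)

lemma dagger_uminus: "dagger (- A) = - dagger A"
  by (simp add: dagger_def transpose_def vec_eq_iff)

lemma matJ_antisym: "matJ $ x $ y = - matJ $ y $ x"
  by (auto simp: matJ_def block_matrix_def mat_def split: sum.split)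

lemma dagger_matJ: "dagger matJ = - matJ"
  unfolding dagger_def cnj_matJ using matJ_antisym
  by (auto simp: transpose_def vec_eq_iff)

lemma matJ_matJ_mult: "matJ ** (matJ ** A) = - A"
  by (simp add: matrix_mul_assoc matJ_mult_matJ matrix_mult_uminus)

lemmas matJ_simps = matrix_mult_uminus matJ_matJ_mult matJ_mult_matJ
  map_matrix_cnj_mult map_matrix_cnj_uminus cnj_matJ map_matrix_cnj_cnj

lemma Theta_conj_mult: "Theta_conj (A ** B) = Theta_conj A ** Theta_conj B"
  by (simp add: Theta_conj_def matrix_mul_assoc[symmetric] matJ_simps)

lemma Theta_conj_Theta_conj: "Theta_conj (Theta_conj A) = A"
  by (simp add: Theta_conj_def matrix_mul_assoc[symmetric] matJ_simps)

lemma Theta_conj_dagger: "Theta_conj (dagger A) = dagger (Theta_conj A)"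
proof -
  have "dagger (map_matrix cnj A) = map_matrix cnj (dagger A)"
    by (simp add: dagger_def transpose_def vec_eq_iff)
  then show ?thesis
    by (simp add: Theta_conj_def dagger_mult dagger_uminus dagger_matJ matrix_mul_assoc[symmetric]
        matJ_simps)
qed

lemma Theta_conj_nth:
  "Theta_conj A $ x $ y = - (\<Sum>a\<in>UNIV. \<Sum>b\<in>UNIV. matJ $ x $ a * cnj (A $ a $ b) * matJ $ b $ y)"
proof -
  have "Theta_conj A $ x $ y
      = - (\<Sum>b\<in>UNIV. \<Sum>a\<in>UNIV. matJ $ x $ a * cnj (A $ a $ b) * matJ $ b $ y)"
    by (simp add: Theta_conj_def matrix_matrix_mult_def sum_distrib_right)
  then show ?thesis
    by (subst (asm) sum.swap)
qed

lemma Theta_conj_add: "Theta_conj (A + B) = Theta_conj A + Theta_conj B"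
  by (simp add: vec_eq_iff Theta_conj_nth algebra_simps sum.distrib)

lemma Theta_conj_mscale: "Theta_conj (mscale c A) = mscale (cnj c) (Theta_conj A)"
  by (simp add: vec_eq_iff Theta_conj_nth mscale_def sum_distrib_left ac_simps)

lemma Theta_conj_zero: "Theta_conj 0 = 0"
  by (simp add: vec_eq_iff Theta_conj_nth)

lemma Theta_conj_sum: "Theta_conj (sum f S) = (\<Sum>x\<in>S. Theta_conj (f x))"
  by (induction S rule: infinite_finite_induct) (simp_all add: Theta_conj_zero Theta_conj_add)

lemma commutes_Theta_iff:
  "(*v) L \<circ> Theta = Theta \<circ> (*v) L \<longleftrightarrow> Theta_conj L = L"
proof -
  have "(*v) L \<circ> Theta = Theta \<circ> (*v) L
      \<longleftrightarrow> (\<forall>v. (L ** matJ) *v kappa v = (matJ ** map_matrix cnj L) *v kappa v)"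
    by (simp add: fun_eq_iff Theta_def kappa_mult matrix_vector_mul_assoc)
  also have "\<dots> \<longleftrightarrow> (\<forall>v. (L ** matJ) *v v = (matJ ** map_matrix cnj L) *v v)"
    by (metis kappa_kappa)
  also have "\<dots> \<longleftrightarrow> L ** matJ = matJ ** map_matrix cnj L"
    by (simp add: matrix_eq)
  also have "\<dots> \<longleftrightarrow> Theta_conj L = L"
  proof
    assume "L ** matJ = matJ ** map_matrix cnj L"
    then show "Theta_conj L = L"
      unfolding Theta_conj_def
      by (metis matrix_mul_assoc matJ_mult_matJ matrix_mult_uminus(1) matrix_mul_rid minus_minus)
  next
    assume "Theta_conj L = L"
    then have "L ** matJ = - (matJ ** map_matrix cnj L ** matJ) ** matJ"
      by (simp add: Theta_conj_def)
    then show "L ** matJ = matJ ** map_matrix cnj L"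
      by (simp add: matrix_mul_assoc[symmetric] matJ_simps)
  qed
  finally show ?thesis .
qed

section \<open>The Choi matrix\<close>

lemma matrix_unit_nth: "matrix_unit a b $ i $ j = (if i = a then if j = b then 1 else 0 else 0)"
  by (simp add: matrix_unit_def axis_def)

lemma sum_if_const: "(\<Sum>x\<in>S. if c then f x else 0) = (if c then sum f S else 0)"
  by simp

lemma sum_UNIV_pair: "(\<Sum>x\<in>UNIV. f x) = (\<Sum>a\<in>UNIV. \<Sum>b\<in>UNIV. f (a, b))"
  by (simp add: sum.cartesian_product)

lemma choi_nth: "choi \<Psi> $ (a, i) $ (b, j) = \<Psi> (matrix_unit a b) $ i $ j"
proof -
  have "choi \<Psi> $ (a, i) $ (b, j)
      = (\<Sum>\<alpha>\<in>UNIV. \<Sum>\<beta>\<in>UNIV. matrix_unit \<alpha> \<beta> $ a $ b * \<Psi> (matrix_unit \<alpha> \<beta>) $ i $ j)"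
    by (simp add: choi_def kron_def)
  then show ?thesis
    by (simp add: matrix_unit_nth mult_delta_left sum_if_const)
qed

lemma matrix_unit_expansion:
  "X = (\<Sum>a\<in>UNIV. \<Sum>b\<in>UNIV. mscale (X $ a $ b) (matrix_unit a b))"
proof -
  have "(\<Sum>a\<in>UNIV. \<Sum>b\<in>UNIV. mscale (X $ a $ b) (matrix_unit a b)) $ i $ j = X $ i $ j" for i j
    by (simp add: mscale_def matrix_unit_nth mult_delta_right sum_if_const)
  then show ?thesis by (simp add: vec_eq_iff)
qed

lemma complex_linear_expansion:
  assumes "complex_linear \<Psi>"
  shows "\<Psi> X = (\<Sum>a\<in>UNIV. \<Sum>b\<in>UNIV. mscale (X $ a $ b) (\<Psi> (matrix_unit a b)))"
proof -
  interpret Vector_Spaces.linear mscale mscale \<Psi> by fact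
  show ?thesis
    by (subst matrix_unit_expansion[of X]) (simp only: sum scale)
qed

text \<open>
  The Choi matrix lists the values on the matrix units, which span.
\<close>

lemma choi_inject:
  assumes "complex_linear \<Psi>" "complex_linear \<Psi>'"
  shows "choi \<Psi> = choi \<Psi>' \<longleftrightarrow> \<Psi> = \<Psi>'"
proof
  assume *: "choi \<Psi> = choi \<Psi>'"
  have eq: "\<Psi> (matrix_unit a b) = \<Psi>' (matrix_unit a b)" for a b
    by (simp add: vec_eq_iff choi_nth[symmetric] *)
  show "\<Psi> = \<Psi>'"
  proof
    show "\<Psi> X = \<Psi>' X" for X
      unfolding complex_linear_expansion[OF assms(1), of X] complex_linear_expansion[OF assms(2), of X]
      by (simp only: eq)
  qed
qed simp

lemma complex_linear_Theta_conj:
  assumes "complex_linear \<Psi>"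
  shows "complex_linear (Theta_conj \<circ> \<Psi> \<circ> Theta_conj)"
proof -
  interpret Vector_Spaces.linear mscale mscale \<Psi> by fact
  show ?thesis
    by unfold_locales (simp_all add: Theta_conj_add Theta_conj_mscale add scale)
qed

text \<open>
  The left-hand side is \<open>\<Sum> \<sigma> E\<^sub>\<alpha>\<^sub>\<beta> \<otimes> \<sigma> (\<Psi> E\<^sub>\<alpha>\<^sub>\<beta>)\<close>, with \<open>\<sigma>\<close> for \<open>Theta_conj\<close>; the two signs in
  \<open>\<sigma>\<close> cancel. Its block at \<open>(a, b)\<close> has the coefficients \<open>(\<sigma> E\<^sub>\<alpha>\<^sub>\<beta>)\<^sub>a\<^sub>b\<close>, and \<open>\<sigma>\<close> is self-adjoint
  in the sense that these are also the (real) coordinates \<open>(\<sigma> E\<^sub>a\<^sub>b)\<^sub>\<alpha>\<^sub>\<beta>\<close>. So the block is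
  \<open>\<sigma> (\<Psi> (\<sigma> E\<^sub>a\<^sub>b))\<close>.
\<close>

lemma choi_Theta_conj:
  fixes \<Psi> :: "complex^('n::finite + 'n)^('n + 'n) \<Rightarrow> complex^('n + 'n)^('n + 'n)"
  assumes "complex_linear \<Psi>"
  shows "kron matJ matJ ** map_matrix cnj (choi \<Psi>) ** kron matJ matJ
       = choi (Theta_conj \<circ> \<Psi> \<circ> Theta_conj)"
proof -
  let ?E = matrix_unit
  have kron: "kron matJ matJ ** map_matrix cnj (kron A B) ** kron matJ matJ
      = kron (Theta_conj A) (Theta_conj B)" for A B :: "complex^('n + 'n)^('n + 'n)"
    by (simp add: map_matrix_cnj_kron kron_mult Theta_conj_def) (simp add: kron_def vec_eq_iff)
  have add: "kron matJ matJ ** map_matrix cnj (sum f S) ** kron matJ matJ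
      = (\<Sum>x\<in>S. kron matJ matJ ** map_matrix cnj (f x) ** kron matJ matJ)"
    for S and f :: "'n + 'n \<Rightarrow> complex^(('n + 'n) \<times> ('n + 'n))^(('n + 'n) \<times> ('n + 'n))"
  proof (induction S rule: infinite_finite_induct)
    case (insert x F)
    then show ?case
      by (simp add: map_matrix_cnj_add matrix_add_ldistrib matrix_mult_add_distrib)
  qed (simp_all add: map_matrix_def zero_vec_def[symmetric])
  have "kron matJ matJ ** map_matrix cnj (choi \<Psi>) ** kron matJ matJ
      = (\<Sum>\<alpha>\<in>UNIV. \<Sum>\<beta>\<in>UNIV. kron (Theta_conj (?E \<alpha> \<beta>)) (Theta_conj (\<Psi> (?E \<alpha> \<beta>))))"
    by (simp only: choi_def add kron)
  moreover have "(\<Sum>\<alpha>\<in>UNIV. \<Sum>\<beta>\<in>UNIV. kron (Theta_conj (?E \<alpha> \<beta>)) (Theta_conj (\<Psi> (?E \<alpha> \<beta>)))) $ (a, i) $ (b, j)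
      = choi (Theta_conj \<circ> \<Psi> \<circ> Theta_conj) $ (a, i) $ (b, j)" for a i b j
  proof -
    have E: "Theta_conj (?E \<alpha> \<beta>) $ x $ y = - (matJ $ x $ \<alpha> * matJ $ \<beta> $ y)" for \<alpha> \<beta> x y :: "'n + 'n"
      by (simp add: Theta_conj_nth matrix_unit_nth if_distrib[of cnj] mult_delta_left mult_delta_right
          sum_if_const cong: if_cong)
    have sym: "Theta_conj (?E \<alpha> \<beta>) $ x $ y = cnj (Theta_conj (?E x y) $ \<alpha> $ \<beta>)" for \<alpha> \<beta> x y :: "'n + 'n"
    proof -
      have r: "cnj (matJ $ x $ \<alpha>) = matJ $ x $ \<alpha>" for x \<alpha> :: "'n + 'n"
        using arg_cong[OF cnj_matJ, of "\<lambda>M. M $ x $ \<alpha>"] by simp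
      show ?thesis
        unfolding E by (simp add: r) (metis matJ_antisym minus_mult_minus)
    qed
    have "Theta_conj (\<Psi> (Theta_conj (?E a b)))
        = (\<Sum>\<alpha>\<in>UNIV. \<Sum>\<beta>\<in>UNIV. mscale (cnj (Theta_conj (?E a b) $ \<alpha> $ \<beta>)) (Theta_conj (\<Psi> (?E \<alpha> \<beta>))))"
      by (subst complex_linear_expansion[OF assms]) (simp only: Theta_conj_sum Theta_conj_mscale)
    then show ?thesis
      by (simp add: choi_nth kron_def mscale_def sym[symmetric])
  qed
  ultimately show ?thesis by (simp add: vec_eq_iff split_paired_all)
qed

lemma frakC_invariant_choi_iff:
  assumes "complex_linear \<Psi>"
  shows "frakC \<circ> (*v) (choi \<Psi>) \<circ> inv frakC = (*v) (choi \<Psi>)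
    \<longleftrightarrow> Theta_conj \<circ> \<Psi> \<circ> Theta_conj = \<Psi>"
proof -
  have "frakC \<circ> (*v) (choi \<Psi>) \<circ> inv frakC
      = (*v) (kron matJ matJ ** map_matrix cnj (choi \<Psi>) ** kron matJ matJ)"
    unfolding inv_frakC
    by (simp add: fun_eq_iff frakC_def kappa_mult kappa_kappa matrix_vector_mul_assoc
        map_matrix_cnj_mult map_matrix_cnj_kron cnj_matJ matrix_mul_assoc)
  also have "\<dots> = (*v) (choi (Theta_conj \<circ> \<Psi> \<circ> Theta_conj))"
    by (simp only: choi_Theta_conj[OF assms])
  finally show ?thesis
    by (simp add: fun_eq_iff[of "(*v) _"] matrix_eq[symmetric] choi_inject
        complex_linear_Theta_conj assms)
qed

section \<open>Kraus families of completely positive maps\<close>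

text \<open>
  As the scalars are complex, a form with nonnegative real values is automatically Hermitian; see
  \<open>psd_hermitian\<close>.
\<close>

definition psd :: "('a::finite \<Rightarrow> 'a \<Rightarrow> complex) \<Rightarrow> bool" where
  "psd M \<longleftrightarrow> (\<forall>v. (\<Sum>a\<in>UNIV. \<Sum>b\<in>UNIV. cnj (v a) * M a b * v b) \<in> \<real>\<^sub>\<ge>\<^sub>0)"

lemma psd_two_points:
  assumes "psd M" "a \<noteq> b"
  shows "cnj s * M a a * s + cnj s * M a b * t + cnj t * M b a * s + cnj t * M b b * t \<in> \<real>\<^sub>\<ge>\<^sub>0"
proof -
  let ?v = "\<lambda>x. if x = a then s else if x = b then t else 0"
  have sum_two: "(\<Sum>x\<in>UNIV. f x) = f a + f b" if "\<And>x. x \<noteq> a \<Longrightarrow> x \<noteq> b \<Longrightarrow> f x = 0" for f :: "_ \<Rightarrow> complex"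
  proof -
    have "sum f UNIV = sum f {a, b}" by (rule sum.mono_neutral_right) (use that in auto)
    then show ?thesis using assms(2) by simp
  qed
  have "(\<Sum>x\<in>UNIV. \<Sum>y\<in>UNIV. cnj (?v x) * M x y * ?v y) \<in> \<real>\<^sub>\<ge>\<^sub>0"
    using assms(1)[unfolded psd_def, rule_format, of ?v] .
  also have "(\<Sum>x\<in>UNIV. \<Sum>y\<in>UNIV. cnj (?v x) * M x y * ?v y)
      = (\<Sum>x\<in>UNIV. cnj (?v x) * M x a * s + cnj (?v x) * M x b * t)"
    using assms(2) by (intro sum.cong refl, subst sum_two) auto
  also have "\<dots> = (cnj s * M a a * s + cnj s * M a b * t) + (cnj t * M b a * s + cnj t * M b b * t)"
    using assms(2) by (subst sum_two) auto
  finally show ?thesis by (simp only: add.assoc)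
qed

lemma psd_diagonal:
  assumes "psd M"
  shows "M a a \<in> \<real>\<^sub>\<ge>\<^sub>0"
proof -
  have "(\<Sum>x\<in>UNIV. \<Sum>y\<in>UNIV. cnj (if x = a then 1 else 0) * M x y * (if y = a then 1 else 0)) \<in> \<real>\<^sub>\<ge>\<^sub>0"
    using assms[unfolded psd_def, rule_format, of "\<lambda>x. if x = a then 1 else 0"] .
  then show ?thesis
    by (simp add: if_distrib[of cnj] mult_delta_left mult_delta_right sum_if_const cong: if_cong)
qed

lemma psd_hermitian:
  assumes "psd M"
  shows "M b a = cnj (M a b)"
proof (cases "a = b")
  case True
  then show ?thesis using psd_diagonal[OF assms, of a] by (auto simp: complex_nonneg_Reals_iff complex_eq_iff)
next
  case False
  note p = psd_two_points[OF assms False]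
  \<comment> \<open>Polarisation: the form is real at \<open>(1, 1)\<close> and at \<open>(1, \<i>)\<close>.\<close>
  have "M a b + M b a \<in> \<real>" "\<i> * (M a b - M b a) \<in> \<real>"
    using p[of 1 1] p[of 1 "\<i>"] psd_diagonal[OF assms, of a] psd_diagonal[OF assms, of b]
    by (auto simp: complex_nonneg_Reals_iff complex_is_Real_iff algebra_simps)
  then show ?thesis
    by (auto simp: complex_is_Real_iff complex_eq_iff)
qed

lemma psd_zero_diagonal:
  assumes "psd M" "M a a = 0"
  shows "M a b = 0"
proof (cases "a = b")
  case False
  define m where "m = Re (M b b)"
  have m: "M b b = of_real m" "m \<ge> 0"
    using psd_diagonal[OF assms(1), of b] by (auto simp: m_def complex_nonneg_Reals_iff complex_eq_iff)
  show ?thesis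
  proof (rule ccontr)
    assume nz: "M a b \<noteq> 0"
    \<comment> \<open>At \<open>(s, 1)\<close> the form takes the value \<open>2 Re (cnj s * M a b) + m\<close>, made equal to \<open>-1\<close> here.\<close>
    define s where "s = - of_real ((m + 1) / 2) / cnj (M a b)"
    have "cnj s * M a b = - of_real ((m + 1) / 2)" "cnj (M a b) * s = - of_real ((m + 1) / 2)"
      using nz by (simp_all add: s_def)
    then have "- of_real ((m + 1) / 2) - of_real ((m + 1) / 2) + complex_of_real m \<in> \<real>\<^sub>\<ge>\<^sub>0"
      using psd_two_points[OF assms(1) False, of s 1] assms(2)
      by (simp add: psd_hermitian[OF assms(1), of b a] m(1))
    then show False by (auto simp: complex_nonneg_Reals_iff)
  qed
qed (use assms in simp)

text \<open>
  The Schur complement at \<open>v\<close> is the original form at the vector \<open>w\<close> that is obtained from \<open>v\<close> by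
  changing the entry at \<open>x\<close> so as to minimise the form.
\<close>

lemma psd_schur_complement:
  assumes "psd M" "M x x \<noteq> 0"
  shows "psd (\<lambda>a b. M a b - M a x * M x b / M x x)"
  unfolding psd_def
proof
  fix v :: "'a \<Rightarrow> complex"
  define r where "r = (\<Sum>b\<in>UNIV. M x b * v b)"
  define w where "w = (\<lambda>a. v a - (if a = x then r / M x x else 0))"
  have real: "cnj (M x x) = M x x" using psd_hermitian[OF assms(1), of x x] by simp
  have r': "(\<Sum>a\<in>UNIV. cnj (v a) * M a x) = cnj r"
    by (simp add: r_def psd_hermitian[OF assms(1), of _ x] mult.commute)
  have nonneg: "(\<Sum>a\<in>UNIV. \<Sum>b\<in>UNIV. cnj (w a) * M a b * w b) \<in> \<real>\<^sub>\<ge>\<^sub>0"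
    using assms(1)[unfolded psd_def, rule_format, of w] .
  have inner: "(\<Sum>b\<in>UNIV. M a b * w b) = (\<Sum>b\<in>UNIV. M a b * v b) - M a x * r / M x x" for a
  proof -
    have "(\<Sum>b\<in>UNIV. M a b * w b)
        = (\<Sum>b\<in>UNIV. M a b * v b - (if b = x then M a b * r / M x x else 0))"
      by (intro sum.cong refl) (simp add: w_def algebra_simps)
    then show ?thesis by (simp add: sum_subtractf)
  qed
  note nonneg
  also have "(\<Sum>a\<in>UNIV. \<Sum>b\<in>UNIV. cnj (w a) * M a b * w b)
      = (\<Sum>a\<in>UNIV. cnj (w a) * ((\<Sum>b\<in>UNIV. M a b * v b) - M a x * r / M x x))"
    by (simp only: inner[symmetric] sum_distrib_left mult.assoc)
  also have "\<dots> = (\<Sum>a\<in>UNIV. cnj (v a) * ((\<Sum>b\<in>UNIV. M a b * v b) - M a x * r / M x x)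
      - (if a = x then cnj (r / M x x) * ((\<Sum>b\<in>UNIV. M a b * v b) - M a x * r / M x x) else 0))"
    by (intro sum.cong refl) (simp add: w_def algebra_simps)
  \<comment> \<open>The correction at \<open>x\<close> pairs to \<open>0\<close>, because \<open>w\<close> is chosen with \<open>(M w) x = 0\<close>.\<close>
  also have "\<dots> = (\<Sum>a\<in>UNIV. cnj (v a) * ((\<Sum>b\<in>UNIV. M a b * v b) - M a x * r / M x x))"
    using assms(2) by (simp add: sum_subtractf r_def[symmetric])
  also have "\<dots> = (\<Sum>a\<in>UNIV. \<Sum>b\<in>UNIV. cnj (v a) * (M a b - M a x * M x b / M x x) * v b)"
    by (intro sum.cong refl)
      (simp add: r_def sum_distrib_left sum_subtractf sum_divide_distrib algebra_simps)
  finally show "(\<Sum>a\<in>UNIV. \<Sum>b\<in>UNIV. cnj (v a) * (M a b - M a x * M x b / M x x) * v b) \<in> \<real>\<^sub>\<ge>\<^sub>0" .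
qed

text \<open>
  Cholesky decomposition: subtracting the rank-one form of the row at \<open>x\<close> leaves the Schur
  complement, whose support no longer contains \<open>x\<close>. If the diagonal entry at \<open>x\<close> vanishes, so does
  the whole row, and nothing has to be subtracted.
\<close>

lemma psd_sum_of_rank_ones:
  assumes "psd M"
  shows "\<exists>(l::nat) w. \<forall>a b. M a b = (\<Sum>s=1..l. w s a * cnj (w s b))"
proof -
  have "\<exists>(l::nat) w. \<forall>a b. M a b = (\<Sum>s=1..l. w s a * cnj (w s b))"
    if "finite S" "psd M" "\<And>a b. a \<notin> S \<Longrightarrow> M a b = 0" for S and M :: "'a \<Rightarrow> 'a \<Rightarrow> complex"
    using that
  proof (induction S arbitrary: M rule: finite_induct)
    case empty
    then show ?case by (intro exI[of _ 0]) auto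
  next
    case (insert x S)
    show ?case
    proof (cases "M x x = 0")
      case True
      have "M a b = 0" if "a \<notin> S" for a b
        using insert.prems(2) psd_zero_diagonal[OF insert.prems(1) True] that by (cases "a = x") auto
      then show ?thesis by (intro insert.IH insert.prems(1))
    next
      case False
      define N where "N = (\<lambda>a b. M a b - M a x * M x b / M x x)"
      have "\<exists>(l::nat) w. \<forall>a b. N a b = (\<Sum>s=1..l. w s a * cnj (w s b))"
      proof (rule insert.IH)
        show "psd N" unfolding N_def by (rule psd_schur_complement[OF insert.prems(1) False])
        show "N a b = 0" if "a \<notin> S" for a b
          using that insert.prems(2)[of a] False by (cases "a = x") (auto simp: N_def)
      qed
      then obtain l w where w: "\<And>a b. N a b = (\<Sum>s=1..l::nat. w s a * cnj (w s b))" by blast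
      define m where "m = Re (M x x)"
      have m: "M x x = of_real m" "m \<ge> 0"
        using psd_diagonal[OF insert.prems(1), of x]
        by (auto simp: m_def complex_nonneg_Reals_iff complex_eq_iff)
      define w' where "w' = (\<lambda>s. if s = Suc l then \<lambda>a. M a x / of_real (sqrt m) else w s)"
      have w'_Suc: "w' (Suc l) a = M a x / of_real (sqrt m)" for a by (simp add: w'_def)
      have "(\<Sum>s=1..l. w' s a * cnj (w' s b)) = N a b" for a b
        unfolding w by (intro sum.cong) (auto simp: w'_def)
      then have "(\<Sum>s=1..Suc l. w' s a * cnj (w' s b))
          = N a b + (M a x / of_real (sqrt m)) * cnj (M b x / of_real (sqrt m))" for a b
        by (simp add: w'_Suc)
      moreover have "N a b + (M a x / of_real (sqrt m)) * cnj (M b x / of_real (sqrt m)) = M a b" for a b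
        using m False psd_hermitian[OF insert.prems(1), of x b]
        by (simp add: N_def flip: of_real_mult)
      ultimately have "M a b = (\<Sum>s=1..Suc l. w' s a * cnj (w' s b))" for a b by presburger
      then show ?thesis by (intro exI[of _ "Suc l"] exI[of _ w'] allI)
    qed
  qed
  from this[OF finite_class.finite_UNIV assms] show ?thesis by simp
qed

lemma sandwich_nth:
  "(L ** X ** dagger L) $ i $ j
    = (\<Sum>a\<in>UNIV. \<Sum>b\<in>UNIV. X $ a $ b * (L $ i $ a * cnj (L $ j $ b)))"
proof -
  have "(L ** X ** dagger L) $ i $ j
      = (\<Sum>b\<in>UNIV. \<Sum>a\<in>UNIV. X $ a $ b * (L $ i $ a * cnj (L $ j $ b)))"
    by (simp add: matrix_matrix_mult_def dagger_def transpose_def sum_distrib_right sum_distrib_left ac_simps)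
  then show ?thesis by (subst (asm) sum.swap)
qed

text \<open>
  The array of all matrix units is positive, being the rank-one form of the unnormalised maximally
  entangled vector; the Choi matrix is its image under \<open>id \<otimes> \<Psi>\<close>.
\<close>

lemma psd_choi:
  fixes \<Psi> :: "complex^'n::finite^'n \<Rightarrow> complex^'n^'n"
  assumes "completely_positive \<Psi>"
  shows "psd (\<lambda>x y. choi \<Psi> $ x $ y)"
proof -
  obtain e where e: "bij_betw e {..<CARD('n)} (UNIV :: 'n set)"
    using ex_bij_betw_nat_finite[OF finite_class.finite_UNIV] by (metis atLeast0LessThan)
  let ?F = "\<lambda>a b. matrix_unit (e a) (e b)"
  have "block_psd CARD('n) ?F"
    unfolding block_psd_def
  proof
    fix v :: "nat \<Rightarrow> complex^'n"
    define z where "z = (\<Sum>a<CARD('n). v a $ e a)"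
    have "(\<Sum>i\<in>UNIV. cnj (v a $ i) * (?F a b *v v b) $ i) = cnj (v a $ e a) * v b $ e b" for a b
    proof -
      have "(?F a b *v v b) $ i = (if i = e a then v b $ e b else 0)" for i
        by (simp add: matrix_vector_mult_def matrix_unit_nth mult_delta_left sum_if_const)
      then show ?thesis by (simp add: if_distrib[of "(*) _"] cong: if_cong)
    qed
    then have "(\<Sum>a<CARD('n). \<Sum>b<CARD('n). \<Sum>i\<in>UNIV. cnj (v a $ i) * (?F a b *v v b) $ i) = cnj z * z"
      by (simp add: z_def sum_product)
    also have "\<dots> \<in> \<real>\<^sub>\<ge>\<^sub>0"
      by (simp add: complex_nonneg_Reals_iff)
    finally show "(\<Sum>a<CARD('n). \<Sum>b<CARD('n). \<Sum>i\<in>UNIV. cnj (v a $ i) * (?F a b *v v b) $ i) \<in> \<real>\<^sub>\<ge>\<^sub>0" .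
  qed
  then have *: "block_psd CARD('n) (\<lambda>a b. \<Psi> (?F a b))"
    using assms unfolding completely_positive_def by blast
  show ?thesis
    unfolding psd_def
  proof
    fix v :: "'n \<times> 'n \<Rightarrow> complex"
    let ?q = "\<lambda>a b. \<Sum>i\<in>UNIV. \<Sum>j\<in>UNIV. cnj (v (a, i)) * \<Psi> (matrix_unit a b) $ i $ j * v (b, j)"
    have "(\<Sum>a<CARD('n). \<Sum>b<CARD('n). ?q (e a) (e b)) \<in> \<real>\<^sub>\<ge>\<^sub>0"
      using *[unfolded block_psd_def, rule_format, of "\<lambda>a. \<chi> i. v (e a, i)"]
      by (simp add: matrix_vector_mult_def sum_distrib_left mult.assoc)
    also have "(\<Sum>a<CARD('n). \<Sum>b<CARD('n). ?q (e a) (e b)) = (\<Sum>a\<in>UNIV. \<Sum>b\<in>UNIV. ?q a b)"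
      by (simp only: sum.reindex_bij_betw[OF e, of "\<lambda>b. ?q _ b"]
          sum.reindex_bij_betw[OF e, of "\<lambda>a. \<Sum>b\<in>UNIV. ?q a b"])
    also have "\<dots> = (\<Sum>a\<in>UNIV. \<Sum>i\<in>UNIV. \<Sum>b\<in>UNIV. \<Sum>j\<in>UNIV.
        cnj (v (a, i)) * \<Psi> (matrix_unit a b) $ i $ j * v (b, j))"
      by (intro sum.cong refl sum.swap)
    also have "\<dots> = (\<Sum>x\<in>UNIV. \<Sum>y\<in>UNIV. cnj (v x) * choi \<Psi> $ x $ y * v y)"
      by (simp only: sum_UNIV_pair choi_nth)
    finally show "(\<Sum>x\<in>UNIV. \<Sum>y\<in>UNIV. cnj (v x) * choi \<Psi> $ x $ y * v y) \<in> \<real>\<^sub>\<ge>\<^sub>0" .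
  qed
qed

text \<open>
  Choi's theorem: each vector in a rank-one decomposition of the Choi matrix, reshaped to a matrix,
  is a Kraus operator.
\<close>

lemma kraus_family_exists:
  fixes \<Psi> :: "complex^'n::finite^'n \<Rightarrow> complex^'n^'n"
  assumes "complex_linear \<Psi>" "completely_positive \<Psi>"
  obtains l L where "kraus_family \<Psi> l L"
proof -
  obtain l :: nat and w where w: "\<forall>x y. choi \<Psi> $ x $ y = (\<Sum>s=1..l. w s x * cnj (w s y))"
    using psd_sum_of_rank_ones[OF psd_choi[OF assms(2)]] by blast
  let ?L = "\<lambda>s. \<chi> i a. w s (a, i)"
  have "\<Psi> X $ i $ j = (\<Sum>s=1..l. ?L s ** X ** dagger (?L s)) $ i $ j" for X i j
  proof -
    have "\<Psi> X $ i $ j = (\<Sum>a\<in>UNIV. \<Sum>b\<in>UNIV. \<Sum>s=1..l. X $ a $ b * (w s (a, i) * cnj (w s (b, j))))"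
      by (subst complex_linear_expansion[OF assms(1)])
        (simp add: mscale_def choi_nth[symmetric] w sum_distrib_left)
    also have "\<dots> = (\<Sum>a\<in>UNIV. \<Sum>s=1..l. \<Sum>b\<in>UNIV. X $ a $ b * (w s (a, i) * cnj (w s (b, j))))"
      by (intro sum.cong refl sum.swap)
    also have "\<dots> = (\<Sum>s=1..l. \<Sum>a\<in>UNIV. \<Sum>b\<in>UNIV. X $ a $ b * (w s (a, i) * cnj (w s (b, j))))"
      by (rule sum.swap)
    finally show ?thesis by (simp add: sandwich_nth)
  qed
  then have "kraus_family \<Psi> l ?L" by (simp add: kraus_family_def vec_eq_iff)
  then show ?thesis by (rule that)
qed

section \<open>Symmetrising a Kraus family\<close>

lemma kraus_family_Theta_conj:
  assumes "kraus_family \<Psi> l L"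
  shows "kraus_family (Theta_conj \<circ> \<Psi> \<circ> Theta_conj) l (\<lambda>s. Theta_conj (L s))"
  using assms
  by (simp add: kraus_family_def Theta_conj_sum Theta_conj_mult Theta_conj_Theta_conj
      Theta_conj_dagger)

text \<open>
  The matrices fixed by \<open>Theta_conj\<close> are a real form of \<open>M\<^sub>d(\<complex>)\<close>. The next two definitions give the
  real and imaginary parts of a matrix with respect to it.
\<close>

definition Theta_Re :: "complex^('n::finite + 'n)^('n + 'n) \<Rightarrow> complex^('n + 'n)^('n + 'n)" where
  "Theta_Re L = mscale (1 / 2) (L + Theta_conj L)"

definition Theta_Im :: "complex^('n::finite + 'n)^('n + 'n) \<Rightarrow> complex^('n + 'n)^('n + 'n)" where
  "Theta_Im L = mscale (- \<i> / 2) (L + mscale (- 1) (Theta_conj L))"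

lemma Theta_conj_Theta_Re: "Theta_conj (Theta_Re L) = Theta_Re L"
  by (simp add: Theta_Re_def Theta_conj_mscale Theta_conj_add Theta_conj_Theta_conj add.commute)

lemma Theta_conj_Theta_Im: "Theta_conj (Theta_Im L) = Theta_Im L"
  by (simp add: Theta_Im_def Theta_conj_mscale Theta_conj_add Theta_conj_Theta_conj)
    (simp add: mscale_def vec_eq_iff algebra_simps)

text \<open>
  With \<open>L = U + \<i> V\<close> and \<open>Theta_conj L = U - \<i> V\<close>, the mixed terms cancel in the sum over the two
  signs.
\<close>

lemma Theta_Re_Im_sandwich:
  "Theta_Re L ** X ** dagger (Theta_Re L) + Theta_Im L ** X ** dagger (Theta_Im L)
    = mscale (1 / 2) (L ** X ** dagger L + Theta_conj L ** X ** dagger (Theta_conj L))"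
proof -
  have "Theta_Re L $ i $ a * cnj (Theta_Re L $ j $ b) + Theta_Im L $ i $ a * cnj (Theta_Im L $ j $ b)
      = (1 / 2) * (L $ i $ a * cnj (L $ j $ b) + Theta_conj L $ i $ a * cnj (Theta_conj L $ j $ b))"
    for i j a b
    by (simp add: Theta_Re_def Theta_Im_def mscale_def field_simps)
  moreover have "x * p + x * q = (1 / 2) * (x * p') + (1 / 2) * (x * q')"
    if "p + q = (1 / 2) * (p' + q')" for x p q p' q' :: complex
    by (simp only: distrib_left[symmetric] that) simp
  ultimately have "X $ a $ b * (Theta_Re L $ i $ a * cnj (Theta_Re L $ j $ b))
      + X $ a $ b * (Theta_Im L $ i $ a * cnj (Theta_Im L $ j $ b))
      = (1 / 2) * (X $ a $ b * (L $ i $ a * cnj (L $ j $ b)))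
        + (1 / 2) * (X $ a $ b * (Theta_conj L $ i $ a * cnj (Theta_conj L $ j $ b)))" for i j a b
    by blast
  then have "(Theta_Re L ** X ** dagger (Theta_Re L) + Theta_Im L ** X ** dagger (Theta_Im L)) $ i $ j
    = (1 / 2) * (L ** X ** dagger L) $ i $ j
      + (1 / 2) * (Theta_conj L ** X ** dagger (Theta_conj L)) $ i $ j" for i j
    by (simp only: vector_add_component sandwich_nth sum.distrib[symmetric] sum_distrib_left)
  then show ?thesis
    by (simp add: vec_eq_iff mscale_def field_simps)
qed

lemma Theta_compatible_kraus_family_exists:
  fixes \<Psi> :: "complex^('n::finite + 'n)^('n + 'n) \<Rightarrow> complex^('n + 'n)^('n + 'n)"
  assumes "kraus_family \<Psi> l L" "Theta_conj \<circ> \<Psi> \<circ> Theta_conj = \<Psi>"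
  obtains L' where "kraus_family \<Psi> (l + l) L'" "\<And>s. Theta_conj (L' s) = L' s"
proof
  let ?L = "\<lambda>s. if s \<le> l then Theta_Re (L s) else Theta_Im (L (s - l))"
  show "Theta_conj (?L s) = ?L s" for s
    by (simp add: Theta_conj_Theta_Re Theta_conj_Theta_Im)
  show "kraus_family \<Psi> (l + l) ?L"
    unfolding kraus_family_def
  proof
    fix X
    have 1: "\<Psi> X = (\<Sum>s=1..l. L s ** X ** dagger (L s))"
      using assms(1) by (simp add: kraus_family_def)
    have 2: "\<Psi> X = (\<Sum>s=1..l. Theta_conj (L s) ** X ** dagger (Theta_conj (L s)))"
      using kraus_family_Theta_conj[OF assms(1)] unfolding assms(2) by (simp add: kraus_family_def)
    have "(\<Sum>s=1..l + l. ?L s ** X ** dagger (?L s))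
        = (\<Sum>s=1..l. ?L s ** X ** dagger (?L s)) + (\<Sum>s=l + 1..l + l. ?L s ** X ** dagger (?L s))"
      by (rule sum.ub_add_nat) simp
    also have "(\<Sum>s=l + 1..l + l. ?L s ** X ** dagger (?L s))
        = (\<Sum>s=1..l. ?L (s + l) ** X ** dagger (?L (s + l)))"
      using sum.shift_bounds_cl_nat_ivl[of "\<lambda>s. ?L s ** X ** dagger (?L s)" 1 l l]
      by (simp add: add.commute)
    also have "(\<Sum>s=1..l. ?L s ** X ** dagger (?L s)) + \<dots>
        = (\<Sum>s=1..l. Theta_Re (L s) ** X ** dagger (Theta_Re (L s))
            + Theta_Im (L s) ** X ** dagger (Theta_Im (L s)))"
      by (simp add: sum.distrib)
    also have "\<dots> = (\<Sum>s=1..l. mscale (1 / 2)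
        (L s ** X ** dagger (L s) + Theta_conj (L s) ** X ** dagger (Theta_conj (L s))))"
      by (simp only: Theta_Re_Im_sandwich)
    also have "\<dots> = mscale (1 / 2) (\<Psi> X + \<Psi> X)"
      by (subst (2) 2, subst 1)
        (simp add: mscale_def vec_eq_iff sum.distrib[symmetric] sum_divide_distrib)
    also have "\<dots> = \<Psi> X" by (simp add: mscale_def vec_eq_iff)
    finally show "\<Psi> X = (\<Sum>s=1..l + l. ?L s ** X ** dagger (?L s))" by simp
  qed
qed

section \<open>The image of the complex representation\<close>

lemma quat_fst_mult: "quat_fst (p * q) = quat_fst p * quat_fst q - quat_snd p * cnj (quat_snd q)"
  by (simp add: quat_fst_def quat_snd_def quat_defs complex_eq_iff algebra_simps)

lemma quat_snd_mult: "quat_snd (p * q) = quat_fst p * quat_snd q + quat_snd p * cnj (quat_fst q)"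
  by (simp add: quat_fst_def quat_snd_def quat_defs complex_eq_iff algebra_simps)

lemma quat_fst_snd_add [simp]:
  "quat_fst (p + q) = quat_fst p + quat_fst q" "quat_snd (p + q) = quat_snd p + quat_snd q"
  by (simp_all add: quat_fst_def quat_snd_def quat_defs complex_eq_iff)

lemma quat_fst_snd_const [simp]:
  "quat_fst 0 = 0" "quat_snd 0 = 0" "quat_fst 1 = 1" "quat_snd 1 = 0"
  by (simp_all add: quat_fst_def quat_snd_def quat_defs complex_eq_iff)

lemma quat_fst_snd_sum:
  "quat_fst (sum f S) = (\<Sum>x\<in>S. quat_fst (f x))" "quat_snd (sum f S) = (\<Sum>x\<in>S. quat_snd (f x))"
  by (induction S rule: infinite_finite_induct) simp_all

lemma quat_fst_snd_cnj:
  "quat_fst (quat_cnj q) = cnj (quat_fst q)" "quat_snd (quat_cnj q) = - quat_snd q"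
  by (simp_all add: quat_fst_def quat_snd_def quat_cnj_def complex_eq_iff)

lemma quat_eqI: "quat_fst p = quat_fst q \<Longrightarrow> quat_snd p = quat_snd q \<Longrightarrow> p = q"
  by (simp add: quat_fst_def quat_snd_def quat_eq_iff)

lemma chi_nth:
  "chi A $ Inl a $ Inl b = quat_fst (A $ a $ b)"
  "chi A $ Inl a $ Inr b = quat_snd (A $ a $ b)"
  "chi A $ Inr a $ Inl b = - cnj (quat_snd (A $ a $ b))"
  "chi A $ Inr a $ Inr b = cnj (quat_fst (A $ a $ b))"
  by (simp_all add: chi_def block_matrix_def Let_def)

lemma all_sum_index: "(\<forall>x. P x) \<longleftrightarrow> (\<forall>a. P (Inl a)) \<and> (\<forall>b. P (Inr b))"
  by (metis sum.exhaust)

lemma chi_inject: "chi A = chi B \<longleftrightarrow> A = B"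
  by (auto simp: vec_eq_iff all_sum_index chi_nth intro: quat_eqI)

lemma chi_mult: "chi (A ** B) = chi A ** chi B"
  by (simp add: vec_eq_iff all_sum_index chi_nth matrix_matrix_mult_def sum_sum_UNIV
      quat_fst_snd_sum quat_fst_mult quat_snd_mult sum.distrib sum_subtractf sum_negf algebra_simps)

lemma chi_quat_dagger: "chi (quat_dagger A) = dagger (chi A)"
  by (simp add: vec_eq_iff all_sum_index chi_nth quat_dagger_def dagger_def transpose_def
      quat_fst_snd_cnj)

lemma chi_mat_1: "chi (mat 1) = mat 1"
  by (simp add: vec_eq_iff all_sum_index chi_nth mat_def)

lemma chi_sum: "chi (sum f S) = (\<Sum>x\<in>S. chi (f x))"
  by (simp add: vec_eq_iff all_sum_index chi_nth quat_fst_snd_sum sum_negf)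

text \<open>
  \<open>Theta_conj\<close> sends the blocks \<open>(P, Q, R, S)\<close> to \<open>(cnj S, - cnj R, - cnj Q, cnj P)\<close>, so the lower blocks
  of a fixed matrix are determined by the upper ones, as for \<open>chi (P + Q j)\<close>.
\<close>

lemma Theta_conj_fixed_imp_chi:
  fixes L :: "complex^('n::finite + 'n)^('n + 'n)"
  assumes "Theta_conj L = L"
  obtains A where "L = chi A"
proof
  let ?A = "\<chi> a b. Quat (Re (L $ Inl a $ Inl b)) (Im (L $ Inl a $ Inl b))
    (Re (L $ Inl a $ Inr b)) (Im (L $ Inl a $ Inr b))"
  have J: "Theta_conj L $ Inr a $ Inl b = - cnj (L $ Inl a $ Inr b)"
    "Theta_conj L $ Inr a $ Inr b = cnj (L $ Inl a $ Inl b)" for a b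
    by (simp_all add: Theta_conj_nth sum_sum_UNIV matJ_def block_matrix_def mat_def
        if_distrib[of "\<lambda>z. z * _"] if_distrib[of "(*) _"] if_distrib[of uminus] sum_negf cong: if_cong)
  show "L = chi ?A"
    using J[unfolded assms]
    by (simp add: vec_eq_iff all_sum_index chi_nth quat_fst_def quat_snd_def)
qed

section \<open>Compatible Kraus families and quaternionic channels\<close>

lemma trace_sandwich_matrix_unit:
  "trace (L ** matrix_unit a b ** dagger L) = (dagger L ** L) $ b $ a"
proof -
  have "trace (L ** matrix_unit a b ** dagger L) = trace (dagger L ** L ** matrix_unit a b)"
    by (metis trace_mul_sym matrix_mul_assoc)
  also have "\<dots> = (dagger L ** L) $ b $ a"
    unfolding trace_def matrix_matrix_mult_def[of _ "matrix_unit a b"]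
    by (simp add: matrix_unit_nth mult_delta_right if_distrib[of "\<lambda>z. z * _"] sum_if_const)
  finally show ?thesis .
qed

text \<open>
  Tested on the matrix units, trace preservation reads off the entries of \<open>\<Sum> L\<^sub>s\<^sup>\<dagger> L\<^sub>s\<close>.
\<close>

lemma trace_preserving_kraus_family:
  assumes "kraus_family \<Psi> l L" "trace_preserving \<Psi>"
  shows "(\<Sum>s=1..l. dagger (L s) ** L s) = mat 1"
proof -
  have "(\<Sum>s=1..l. dagger (L s) ** L s) $ b $ a = mat 1 $ b $ a" for a b
  proof -
    have t: "trace (sum f S) = (\<Sum>x\<in>S. trace (f x))" for f :: "nat \<Rightarrow> complex^'a^'a" and S
      by (simp add: trace_def) (rule sum.swap)
    have "(\<Sum>s=1..l. dagger (L s) ** L s) $ b $ a = trace (\<Psi> (matrix_unit a b))"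
      using assms(1) by (simp add: kraus_family_def t trace_sandwich_matrix_unit)
    also have "\<dots> = trace (matrix_unit a b)" using assms(2) by (simp add: trace_preserving_def)
    also have "\<dots> = (\<Sum>i\<in>UNIV. if i = a then mat 1 $ b $ i else 0)"
      unfolding trace_def by (intro sum.cong refl) (auto simp: matrix_unit_def axis_def mat_def)
    finally show ?thesis by simp
  qed
  then show ?thesis by (simp add: vec_eq_iff)
qed

theorem theorem4:
  fixes \<Psi> :: "complex^('n::finite + 'n)^('n + 'n) \<Rightarrow> complex^('n + 'n)^('n + 'n)"
  assumes "complex_linear \<Psi>"
    and "completely_positive \<Psi>"
    and "trace_preserving \<Psi>"
  shows "((\<exists>l L. kraus_family \<Psi> l L \<and> (\<forall>s\<in>{1..l}. (*v) (L s) \<circ> Theta = Theta \<circ> (*v) (L s)))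
          \<longleftrightarrow> frakC \<circ> (*v) (choi \<Psi>) \<circ> inv frakC = (*v) (choi \<Psi>))
       \<and> ((\<exists>l L. kraus_family \<Psi> l L \<and> (\<forall>s\<in>{1..l}. (*v) (L s) \<circ> Theta = Theta \<circ> (*v) (L s)))
          \<longrightarrow> (\<exists>l L (A :: nat \<Rightarrow> quat^'n^'n) \<Phi>.
                 kraus_family \<Psi> l L
               \<and> (\<forall>s\<in>{1..l}. (*v) (L s) \<circ> Theta = Theta \<circ> (*v) (L s))
               \<and> (\<forall>s\<in>{1..l}. L s = chi (A s))
               \<and> quaternionic_channel_given_by \<Phi> l A
               \<and> (\<forall>X. \<Psi> X = complex_representation l A X)))"
proof (intro conjI iffI impI)
  assume "\<exists>l L. kraus_family \<Psi> l L \<and> (\<forall>s\<in>{1..l}. (*v) (L s) \<circ> Theta = Theta \<circ> (*v) (L s))"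
  then obtain l L where K: "kraus_family \<Psi> l L" and L: "\<And>s. s \<in> {1..l} \<Longrightarrow> Theta_conj (L s) = L s"
    by (auto simp: commutes_Theta_iff)
  have "Theta_conj \<circ> \<Psi> \<circ> Theta_conj = \<Psi>"
    using K kraus_family_Theta_conj[OF K] by (simp add: kraus_family_def fun_eq_iff L)
  then show "frakC \<circ> (*v) (choi \<Psi>) \<circ> inv frakC = (*v) (choi \<Psi>)"
    by (simp add: frakC_invariant_choi_iff assms(1))
next
  assume "frakC \<circ> (*v) (choi \<Psi>) \<circ> inv frakC = (*v) (choi \<Psi>)"
  then have inv: "Theta_conj \<circ> \<Psi> \<circ> Theta_conj = \<Psi>"
    by (simp add: frakC_invariant_choi_iff assms(1))
  obtain l L where "kraus_family \<Psi> l L"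
    using kraus_family_exists[OF assms(1,2)] .
  from Theta_compatible_kraus_family_exists[OF this inv]
  show "\<exists>l L. kraus_family \<Psi> l L \<and> (\<forall>s\<in>{1..l}. (*v) (L s) \<circ> Theta = Theta \<circ> (*v) (L s))"
    unfolding commutes_Theta_iff by metis
next
  assume "\<exists>l L. kraus_family \<Psi> l L \<and> (\<forall>s\<in>{1..l}. (*v) (L s) \<circ> Theta = Theta \<circ> (*v) (L s))"
  then obtain l L where K: "kraus_family \<Psi> l L"
    and L: "\<forall>s\<in>{1..l}. (*v) (L s) \<circ> Theta = Theta \<circ> (*v) (L s)" by blast
  have "\<forall>s\<in>{1..l}. \<exists>A. L s = chi A"
    using L Theta_conj_fixed_imp_chi unfolding commutes_Theta_iff by metis
  then obtain A :: "nat \<Rightarrow> quat^'n^'n" where A: "\<forall>s\<in>{1..l}. L s = chi (A s)" by metis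
  have "chi (\<Sum>s=1..l. quat_dagger (A s) ** A s) = (\<Sum>s=1..l. dagger (L s) ** L s)"
    using A by (simp add: chi_sum chi_mult chi_quat_dagger)
  also have "\<dots> = chi (mat 1)"
    using trace_preserving_kraus_family[OF K assms(3)] by (simp add: chi_mat_1)
  finally have "(\<Sum>s=1..l. quat_dagger (A s) ** A s) = mat 1" by (simp add: chi_inject)
  then have "quaternionic_channel_given_by (\<lambda>\<rho>. \<Sum>r=1..l. A r ** \<rho> ** quat_dagger (A r)) l A"
    by (simp add: quaternionic_channel_given_by_def)
  moreover have "\<forall>X. \<Psi> X = complex_representation l A X"
    using K A by (simp add: kraus_family_def complex_representation_def)
  ultimately show "\<exists>l L (A :: nat \<Rightarrow> quat^'n^'n) \<Phi>. kraus_family \<Psi> l L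
      \<and> (\<forall>s\<in>{1..l}. (*v) (L s) \<circ> Theta = Theta \<circ> (*v) (L s))
      \<and> (\<forall>s\<in>{1..l}. L s = chi (A s))
      \<and> quaternionic_channel_given_by \<Phi> l A
      \<and> (\<forall>X. \<Psi> X = complex_representation l A X)"
    using K L A by blast
qed

end
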